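(* Let $n,m\in\mathbb{N}$. Suppose $\Phi\in\mathbb{K}^{n\times m}$ is a frame for $\mathbb{K}^n$ with $m$ frame vectors and (optimal) lower frame bound $A$. Then the following assertions hold: (i) If $m\ge 2n$, then for every $c\ge\frac1A$ there exists a tight dual frame $\Psi$ of $\Phi$ with frame bound $c$. (ii) If $m=2n-1$, then there exists a tight dual frame $\Psi$ of $\Phi$; the only possible frame bound of a tight dual frame is $\frac1A$. (iii) Suppose $m<2n-1$. Then there exists a tight dual frame $\Psi$ of $\Phi$ if and only if the smallest $2n-m\in\{2,\dots,n\}$ singular values of $\Phi$ (counted with multiplicity) are equal.
   Context: $\mathbb{K}$ denotes $\mathbb{R}$ or $\mathbb{C}$. A frame for $\mathbb{K}^n$ with $m$ vectors is a family $(\phi_i)_{i=1}^m$ in $\mathbb{K}^n$ for which there are constants $0<A\le B$ (frame bounds) with $A\|x\|_2^2\le\sum_{i=1}^m|\langle x,\phi_i\rangle|^2\le B\|x\|_2^2$ for all $x\in\mathbb{K}^n$ (so $m\ge n$); it is identified with the $n\times m$ matrix $\Phi$ whose columns are the $\phi_i$. The frame is tight with frame bound $c$ if this holds with $A=B=c$, i.e., $\Phi\Phi^*=cI_n$. The optimal lower frame bound is the largest possible $A$, i.e., $A=\sigma_n^2$, where $\sigma_1\ge\dots\ge\sigma_n>0$ are the singular values of the matrix $\Phi$. A dual frame of $\Phi$ is a frame $\Psi\in\mathbb{K}^{n\times m}$ for $\mathbb{K}^n$ with $\Psi\Phi^*=I_n$; a tight dual frame is a dual frame which is tight. *)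

theory Defs
  imports
    "Jordan_Normal_Form.Schur_Decomposition"
    "HOL-Library.Multiset"
    "HOL-Analysis.L2_Norm"
begin

text \<open>
  The scalar field \<open>K\<close> is either \<^term>\<open>\<real> :: complex set\<close> or \<^term>\<open>UNIV :: complex set\<close>.
  Vectors and matrices over \<open>K\<close> are complex ones with all entries in \<open>K\<close>; in the real case
  the conjugations below act trivially.
\<close>

definition vecs_over :: "complex set \<Rightarrow> nat \<Rightarrow> complex vec set" where
  "vecs_over K n = {x \<in> carrier_vec n. vec_set x \<subseteq> K}"

definition mats_over :: "complex set \<Rightarrow> nat \<Rightarrow> nat \<Rightarrow> complex mat set" where
  "mats_over K n m = {M \<in> carrier_mat n m. elements_mat M \<subseteq> K}"

definition norm2 :: "complex vec \<Rightarrow> real" where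
  "norm2 x = L2_set (\<lambda>j. cmod (x $ j)) {..<dim_vec x}"

text \<open>
  The frame vectors are the columns of the matrix. The library's \<open>x \<bullet>c y\<close> is conjugate-linear
  in the second argument.
\<close>

definition frame_bounds ::
  "complex set \<Rightarrow> nat \<Rightarrow> nat \<Rightarrow> complex mat \<Rightarrow> real \<Rightarrow> real \<Rightarrow> bool" where
  "frame_bounds K n m \<Phi> A B \<longleftrightarrow>
     0 < A \<and> A \<le> B \<and>
     (\<forall>x \<in> vecs_over K n.
        A * (norm2 x)\<^sup>2 \<le> (\<Sum>i<m. (cmod (x \<bullet>c col \<Phi> i))\<^sup>2) \<and>
        (\<Sum>i<m. (cmod (x \<bullet>c col \<Phi> i))\<^sup>2) \<le> B * (norm2 x)\<^sup>2)"

definition is_frame :: "complex set \<Rightarrow> nat \<Rightarrow> nat \<Rightarrow> complex mat \<Rightarrow> bool" where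
  "is_frame K n m \<Phi> \<longleftrightarrow> \<Phi> \<in> mats_over K n m \<and> (\<exists>A B. frame_bounds K n m \<Phi> A B)"

definition is_tight_frame :: "complex set \<Rightarrow> nat \<Rightarrow> nat \<Rightarrow> complex mat \<Rightarrow> real \<Rightarrow> bool" where
  "is_tight_frame K n m \<Phi> c \<longleftrightarrow> \<Phi> \<in> mats_over K n m \<and> frame_bounds K n m \<Phi> c c"

definition optimal_lower_frame_bound ::
  "complex set \<Rightarrow> nat \<Rightarrow> nat \<Rightarrow> complex mat \<Rightarrow> real \<Rightarrow> bool" where
  "optimal_lower_frame_bound K n m \<Phi> A \<longleftrightarrow>
     (\<exists>B. frame_bounds K n m \<Phi> A B) \<and>
     (\<forall>A' B'. frame_bounds K n m \<Phi> A' B' \<longrightarrow> A' \<le> A)"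

definition is_dual_frame ::
  "complex set \<Rightarrow> nat \<Rightarrow> nat \<Rightarrow> complex mat \<Rightarrow> complex mat \<Rightarrow> bool" where
  "is_dual_frame K n m \<Phi> \<Psi> \<longleftrightarrow> is_frame K n m \<Psi> \<and> \<Psi> * mat_adjoint \<Phi> = 1\<^sub>m n"

definition is_tight_dual_frame ::
  "complex set \<Rightarrow> nat \<Rightarrow> nat \<Rightarrow> complex mat \<Rightarrow> complex mat \<Rightarrow> real \<Rightarrow> bool" where
  "is_tight_dual_frame K n m \<Phi> \<Psi> c \<longleftrightarrow>
     is_dual_frame K n m \<Phi> \<Psi> \<and> is_tight_frame K n m \<Psi> c"

text \<open>
  The singular values in decreasing order, with multiplicity: the square roots of the eigenvalues
  of \<open>\<Phi> \<Phi>\<^sup>*\<close>, which are real and nonnegative, so that \<^const>\<open>Re\<close> only changes the type. The list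
  has one entry per row of \<open>\<Phi>\<close>; this is the usual convention for matrices with at most as many
  rows as columns, which covers all frames.
\<close>

definition singular_values :: "complex mat \<Rightarrow> real list" where
  "singular_values \<Phi> =
     rev (sorted_list_of_multiset
       (image_mset (\<lambda>z. sqrt (Re z)) (proots (char_poly (\<Phi> * mat_adjoint \<Phi>)))))"

end

theory Submission
  imports Defs "Jordan_Normal_Form.Spectral_Radius"
begin

text \<open>
  Write \<open>\<Phi> \<Phi>\<^sup>* = U diag(d) U\<^sup>*\<close> with \<open>U\<close> unitary over \<open>K\<close>, and \<open>T = (\<Phi> \<Phi>\<^sup>*)\<^sup>-\<^sup>1\<close>. The duals of \<open>\<Phi>\<close> are the
  matrices \<open>\<Psi> = T \<Phi> + W\<close> with \<open>W \<Phi>\<^sup>* = 0\<close>, and \<open>\<Psi> \<Psi>\<^sup>* = T + W W\<^sup>*\<close>. Hence \<open>\<Psi>\<close> is tight with bound \<open>c\<close>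
  iff \<open>W W\<^sup>* = c I - T\<close>. Since the rows of \<open>W\<close> range over a space of dimension \<open>m - n\<close>, such a \<open>W\<close> exists
  iff \<open>c I - T\<close> is positive semidefinite of rank at most \<open>m - n\<close>, that is, iff \<open>c \<ge> 1 / A\<close> and at
  least \<open>2n - m\<close> of the \<open>d i\<close> equal \<open>1 / c\<close>. If \<open>m < 2n\<close>, the latter forces \<open>c = 1 / A\<close>.
\<close>

subsection \<open>Adjoints and products\<close>

lemma adjoint_simps [simp]:
  "dim_row (mat_adjoint A) = dim_col A"
  "dim_col (mat_adjoint A) = dim_row A"
  "i < dim_col A \<Longrightarrow> j < dim_row A \<Longrightarrow> mat_adjoint A $$ (i, j) = conjugate (A $$ (j, i))"
  by (auto simp: mat_adjoint_def mat_of_rows_def)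

lemma adjoint_carrier [simp]: "A \<in> carrier_mat n m \<Longrightarrow> mat_adjoint A \<in> carrier_mat m n"
  by (metis adjoint_simps(1,2) carrier_matD carrier_matI)

lemma adjoint_adjoint [simp]: "mat_adjoint (mat_adjoint A) = (A :: complex mat)"
  by (rule eq_matI) auto

lemma index_mult_mat_sum:
  assumes "i < dim_row A" "j < dim_col B" "dim_col A = dim_row B"
  shows "(A * B) $$ (i, j) = (\<Sum>k<dim_row B. A $$ (i, k) * B $$ (k, j))"
  using assms by (auto simp: scalar_prod_def atLeast0LessThan intro!: sum.cong)

lemma adjoint_mult:
  fixes A B :: "complex mat"
  assumes "dim_col A = dim_row B"
  shows "mat_adjoint (A * B) = mat_adjoint B * mat_adjoint A"
  using assms by (intro eq_matI) (auto simp: index_mult_mat_sum mult.commute simp del: index_mult_mat(1))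

lemma adjoint_minus:
  fixes A B :: "complex mat"
  assumes "dim_row A = dim_row B" "dim_col A = dim_col B"
  shows "mat_adjoint (A - B) = mat_adjoint A - mat_adjoint B"
  using assms by (intro eq_matI) auto

lemma adjoint_add:
  fixes A B :: "complex mat"
  assumes "dim_row A = dim_row B" "dim_col A = dim_col B"
  shows "mat_adjoint (A + B) = mat_adjoint A + mat_adjoint B"
  using assms by (intro eq_matI) auto

lemma adjoint_one [simp]: "mat_adjoint (1\<^sub>m n) = (1\<^sub>m n :: complex mat)"
  by (rule eq_matI) auto

text \<open>The hypotheses are equations between dimensions, which the simplifier can discharge
  without having to guess the dimensions of carrier sets. The same holds for the rules that
  follow.\<close>

lemma mult_assoc_dim:
  fixes A :: "'a :: semiring_0 mat"
  assumes "dim_col A = dim_row B" "dim_col B = dim_row C"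
  shows "A * B * C = A * (B * C)"
  by (rule assoc_mult_mat[of A "dim_row A" "dim_row B" B "dim_row C" C "dim_col C"])
     (use assms in auto)

lemma mult_distribs_dim:
  fixes A :: "'a :: ring mat"
  shows "dim_row A = dim_row B \<Longrightarrow> dim_col A = dim_col B \<Longrightarrow> dim_col A = dim_row C
           \<Longrightarrow> (A + B) * C = A * C + B * C"
    and "dim_row A = dim_row B \<Longrightarrow> dim_col A = dim_col B \<Longrightarrow> dim_col A = dim_row C
           \<Longrightarrow> (A - B) * C = A * C - B * C"
    and "dim_row A = dim_row B \<Longrightarrow> dim_col A = dim_col B \<Longrightarrow> dim_col C = dim_row A
           \<Longrightarrow> C * (A + B) = C * A + C * B"
    and "dim_row A = dim_row B \<Longrightarrow> dim_col A = dim_col B \<Longrightarrow> dim_col C = dim_row A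
           \<Longrightarrow> C * (A - B) = C * A - C * B"
  by (rule add_mult_distrib_mat minus_mult_distrib_mat mult_add_distrib_mat mult_minus_distrib_mat;
      (rule carrier_matI; simp)?; simp)+

lemma one_mult_dim [simp]:
  fixes A :: "'a :: semiring_1 mat"
  shows "dim_row A = n \<Longrightarrow> 1\<^sub>m n * A = A" "dim_col A = n \<Longrightarrow> A * 1\<^sub>m n = A"
  by (auto intro: left_mult_one_mat right_mult_one_mat)

lemma zero_mult_dim [simp]:
  fixes A :: "'a :: semiring_0 mat"
  shows "dim_row A = m \<Longrightarrow> 0\<^sub>m n m * A = 0\<^sub>m n (dim_col A)"
    and "dim_col A = m \<Longrightarrow> A * 0\<^sub>m m n = 0\<^sub>m (dim_row A) n"
  by (auto intro: left_mult_zero_mat right_mult_zero_mat)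

lemma dim_mat_diag [simp]: "dim_row (mat_diag n f) = n" "dim_col (mat_diag n f) = n"
  by (auto simp: mat_diag_def)

lemma index_mat_diag [simp]:
  "i < n \<Longrightarrow> j < n \<Longrightarrow> mat_diag n f $$ (i, j) = (if i = j then f j else 0)"
  by (auto simp: mat_diag_def)

lemma adjoint_mat_diag: "mat_adjoint (mat_diag n (f :: nat \<Rightarrow> complex)) = mat_diag n (\<lambda>i. cnj (f i))"
  by (rule eq_matI) auto

text \<open>Cyclicity of the trace for rectangular factors: both sides are the same double sum. It
  turns traces of \<open>m\<close>-by-\<open>m\<close> projections into traces of
  \<open>n\<close>-by-\<open>n\<close> matrices that can be read off.\<close>

lemma diag_trace_comm:
  fixes A B :: "'a :: comm_semiring_0 mat"
  assumes "dim_col A = dim_row B" "dim_col B = dim_row A"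
  shows "(\<Sum>i<dim_row A. (A * B) $$ (i, i)) = (\<Sum>j<dim_row B. (B * A) $$ (j, j))"
proof -
  have "(\<Sum>i<dim_row A. (A * B) $$ (i, i)) = (\<Sum>i<dim_row A. \<Sum>k<dim_row B. A $$ (i, k) * B $$ (k, i))"
    using assms by (intro sum.cong) (auto simp: index_mult_mat_sum simp del: index_mult_mat(1))
  also have "\<dots> = (\<Sum>k<dim_row B. \<Sum>i<dim_row A. A $$ (i, k) * B $$ (k, i))"
    by (rule sum.swap)
  also have "\<dots> = (\<Sum>j<dim_row B. (B * A) $$ (j, j))"
    using assms by (intro sum.cong) (auto simp: index_mult_mat_sum mult.commute simp del: index_mult_mat(1))
  finally show ?thesis .
qed

text \<open>The diagonal entries are squared row norms; the positivity statements about tight duals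
  and projections below rest on this.\<close>

lemma index_mult_adjoint_self:
  fixes A :: "complex mat"
  assumes "i < dim_row A"
  shows "(A * mat_adjoint A) $$ (i, i) = of_real (\<Sum>k<dim_col A. (cmod (A $$ (i, k)))\<^sup>2)"
  using assms by (auto simp: index_mult_mat_sum complex_norm_square simp del: index_mult_mat(1) of_real_power)

subsection \<open>Matrices over the scalar field\<close>

text \<open>Both choices are fields that contain the reals and are closed under conjugation. Apart
  from these closure properties, the two cases are distinguished only for the existence of
  eigenvectors.\<close>

definition scalar_field :: "complex set \<Rightarrow> bool" where
  "scalar_field K \<longleftrightarrow> K = \<real> \<or> K = UNIV"

lemma mats_over_iff:
  "M \<in> mats_over K n m \<longleftrightarrow> M \<in> carrier_mat n m \<and> (\<forall>i<n. \<forall>j<m. M $$ (i, j) \<in> K)"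
  unfolding mats_over_def by (force intro: elements_matI dest: elements_matD)

lemma vecs_over_iff: "x \<in> vecs_over K n \<longleftrightarrow> x \<in> carrier_vec n \<and> (\<forall>i<n. x $ i \<in> K)"
  unfolding vecs_over_def vec_set_def by auto

lemma mats_over_dim: "M \<in> mats_over K n m \<Longrightarrow> dim_row M = n" "M \<in> mats_over K n m \<Longrightarrow> dim_col M = m"
  by (auto simp: mats_over_iff)

lemma scalar_field_closed:
  assumes "scalar_field K"
  shows "x \<in> K \<Longrightarrow> y \<in> K \<Longrightarrow> x + y \<in> K" "x \<in> K \<Longrightarrow> y \<in> K \<Longrightarrow> x - y \<in> K"
    "x \<in> K \<Longrightarrow> y \<in> K \<Longrightarrow> x * y \<in> K" "x \<in> K \<Longrightarrow> cnj x \<in> K" "of_real r \<in> K" "0 \<in> K" "1 \<in> K"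
    "(\<And>i. i \<in> I \<Longrightarrow> f i \<in> K) \<Longrightarrow> sum f I \<in> K" "x \<in> K \<Longrightarrow> - x \<in> K"
  using assms by (auto simp: scalar_field_def Reals_cnj_iff)

lemma mats_over_closed:
  assumes "scalar_field K"
  shows "M \<in> mats_over K n k \<Longrightarrow> N \<in> mats_over K k m \<Longrightarrow> M * N \<in> mats_over K n m"
    "M \<in> mats_over K n m \<Longrightarrow> N \<in> mats_over K n m \<Longrightarrow> M + N \<in> mats_over K n m"
    "M \<in> mats_over K n m \<Longrightarrow> N \<in> mats_over K n m \<Longrightarrow> M - N \<in> mats_over K n m"
    "M \<in> mats_over K n m \<Longrightarrow> mat_adjoint M \<in> mats_over K m n"
    "1\<^sub>m n \<in> mats_over K n n"
    "mat_diag n (\<lambda>i. of_real (d i)) \<in> mats_over K n n"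
  by (auto simp: mats_over_iff index_mult_mat_sum simp del: index_mult_mat(1)
      intro!: scalar_field_closed[OF assms])

subsection \<open>The spectral theorem over \<open>K\<close>\<close>

definition unitary_over :: "complex set \<Rightarrow> nat \<Rightarrow> complex mat \<Rightarrow> bool" where
  "unitary_over K n U \<longleftrightarrow>
     U \<in> mats_over K n n \<and> mat_adjoint U * U = 1\<^sub>m n \<and> U * mat_adjoint U = 1\<^sub>m n"

lemma unitary_overD:
  assumes "unitary_over K n U"
  shows "U \<in> mats_over K n n" "U \<in> carrier_mat n n" "dim_row U = n" "dim_col U = n"
    "mat_adjoint U * U = 1\<^sub>m n" "U * mat_adjoint U = 1\<^sub>m n"
  using assms by (auto simp: unitary_over_def mats_over_iff)

text \<open>Once \<open>mult_assoc_dim\<close> has nested all products to the right, these rules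
  remove adjacent pairs of \<open>U\<close> and its adjoint.\<close>

lemma unitary_over_cancel:
  assumes "unitary_over K n U" "dim_row A = n"
  shows "mat_adjoint U * (U * A) = A" "U * (mat_adjoint U * A) = A"
  using assms unitary_overD[OF assms(1)]
  by (auto simp flip: mult_assoc_dim)

lemma unitary_over_mult:
  assumes "scalar_field K" "unitary_over K n U" "unitary_over K n V"
  shows "unitary_over K n (U * V)"
  using unitary_overD[OF assms(2)] unitary_overD[OF assms(3)] mats_over_closed(1)[OF assms(1)]
    unitary_over_cancel[OF assms(2)] unitary_over_cancel[OF assms(3)]
  by (simp add: unitary_over_def adjoint_mult mult_assoc_dim)

lemma inner_adjoint:
  fixes A :: "complex mat"
  assumes "dim_vec x = dim_col A" "dim_vec y = dim_row A"
  shows "(A *\<^sub>v x) \<bullet>c y = x \<bullet>c (mat_adjoint A *\<^sub>v y)"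
proof -
  have "(A *\<^sub>v x) \<bullet>c y = (\<Sum>i<dim_row A. \<Sum>j<dim_col A. A $$ (i, j) * x $ j * cnj (y $ i))"
    using assms by (auto simp: scalar_prod_def atLeast0LessThan sum_distrib_right intro!: sum.cong)
  also have "\<dots> = (\<Sum>j<dim_col A. \<Sum>i<dim_row A. A $$ (i, j) * x $ j * cnj (y $ i))"
    by (rule sum.swap)
  also have "\<dots> = x \<bullet>c (mat_adjoint A *\<^sub>v y)"
    using assms by (auto simp: scalar_prod_def atLeast0LessThan sum_distrib_left mult_ac intro!: sum.cong)
  finally show ?thesis .
qed

lemma inner_self: "x \<bullet>c x = of_real ((norm2 x)\<^sup>2)"
  by (auto simp: norm2_def L2_set_def scalar_prod_def atLeast0LessThan complex_norm_square sum_nonneg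
      simp del: of_real_power)

lemma norm2_eq_0_iff: "norm2 x = 0 \<longleftrightarrow> x = 0\<^sub>v (dim_vec x)"
proof -
  have "norm2 x = 0 \<longleftrightarrow> (\<forall>i<dim_vec x. x $ i = 0)"
    by (auto simp: norm2_def L2_set_eq_0_iff)
  thus ?thesis by (metis eq_vecI index_zero_vec)
qed

lemma norm2_smult: "norm2 (a \<cdot>\<^sub>v x) = cmod a * norm2 x"
  by (simp add: norm2_def L2_set_right_distrib norm_mult cong: L2_set_cong_simp)

section \<open>Eigenvectors of Hermitian matrices with entries in \<open>K\<close>\<close>

lemma hermitian_eigenvalue_real:
  fixes H :: "complex mat"
  assumes "H \<in> carrier_mat n n" "mat_adjoint H = H" "eigenvector H v e"
  shows "e \<in> \<real>"
proof -
  have v: "v \<in> carrier_vec n" "v \<noteq> 0\<^sub>v n" "H *\<^sub>v v = e \<cdot>\<^sub>v v"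
    using assms by (auto simp: eigenvector_def)
  have "e * (v \<bullet>c v) = (H *\<^sub>v v) \<bullet>c v" using v by simp
  also have "\<dots> = v \<bullet>c (H *\<^sub>v v)"
    using inner_adjoint[of v H v] assms v by auto
  also have "\<dots> = cnj e * (v \<bullet>c v)" using v by (simp add: conjugate_smult_vec)
  finally have "e = cnj e" using v by simp
  thus ?thesis by (simp add: Reals_cnj_iff)
qed

text \<open>A complex eigenvector exists, and its eigenvalue is real. If \<open>H\<close> is real
  too, the real and imaginary parts of the eigenvector satisfy the same equation, and one of them is
  nonzero.\<close>

lemma hermitian_eigenvector_over:
  assumes K: "scalar_field K" and H: "H \<in> mats_over K n n" "mat_adjoint H = H" and n: "n > 0"
  obtains v e where "v \<in> vecs_over K n" "v \<noteq> 0\<^sub>v n" "H *\<^sub>v v = of_real e \<cdot>\<^sub>v v"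
proof -
  have Hc: "H \<in> carrier_mat n n" using H by (simp add: mats_over_iff)
  obtain c where "c \<in> spectrum H" using spectrum_non_empty[OF Hc] n by auto
  then obtain v where v: "eigenvector H v c"
    by (auto simp: spectrum_def eigenvalue_def)
  then obtain e where e: "c = of_real e"
    using hermitian_eigenvalue_real[OF Hc H(2) v] by (auto elim: Reals_cases)
  have v': "v \<in> carrier_vec n" "v \<noteq> 0\<^sub>v n" "H *\<^sub>v v = of_real e \<cdot>\<^sub>v v"
    using v e Hc by (auto simp: eigenvector_def)
  show thesis
  proof (cases "K = UNIV")
    case True
    thus ?thesis using that v' by (auto simp: vecs_over_iff)
  next
    case False
    hence R: "K = \<real>" using K by (simp add: scalar_field_def)
    have rowsum: "(\<Sum>j<n. H $$ (i, j) * v $ j) = of_real e * v $ i" if "i < n" for i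
      using arg_cong[OF v'(3), of "\<lambda>x. x $ i"] that v'(1) Hc
      by (simp add: scalar_prod_def atLeast0LessThan)
    have H_real: "H $$ (i, j) = of_real (Re (H $$ (i, j)))" if "i < n" "j < n" for i j
      using H that R by (auto simp: mats_over_iff complex_is_Real_iff complex_eq_iff)
    \<comment> \<open>Both \<open>Re\<close> and \<open>Im\<close> are additive and commute with
      real factors, so they can be applied to each row of the eigenvalue equation.\<close>
    have part: "H *\<^sub>v vec n (\<lambda>i. of_real (f (v $ i))) = of_real e \<cdot>\<^sub>v vec n (\<lambda>i. of_real (f (v $ i)))"
      if f: "f = Re \<or> f = Im" for f
    proof (rule eq_vecI)
      fix i assume "i < dim_vec (of_real e \<cdot>\<^sub>v vec n (\<lambda>i. complex_of_real (f (v $ i))))"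
      hence i: "i < n" by simp
      have "f (of_real e * v $ i) = f (\<Sum>j<n. of_real (Re (H $$ (i, j))) * v $ j)"
        using rowsum[OF i] H_real i by simp
      hence "e * f (v $ i) = (\<Sum>j<n. Re (H $$ (i, j)) * f (v $ j))"
        using f by auto
      hence "(\<Sum>j<n. of_real (Re (H $$ (i, j))) * of_real (f (v $ j))) = complex_of_real (e * f (v $ i))"
        by simp
      thus "(H *\<^sub>v vec n (\<lambda>i. of_real (f (v $ i)))) $ i
          = (of_real e \<cdot>\<^sub>v vec n (\<lambda>i. complex_of_real (f (v $ i)))) $ i"
        using i Hc H_real by (simp add: scalar_prod_def atLeast0LessThan)
    qed (use Hc in auto)
    obtain k where k: "k < n" "v $ k \<noteq> 0"
      using v'(1,2) by (metis carrier_vecD eq_vecI index_zero_vec)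
    then obtain f where f: "f = Re \<or> f = Im" "f (v $ k) \<noteq> 0"
      by (metis complex_eq_iff zero_complex.simps)
    show ?thesis
    proof (rule that[OF _ _ part[OF f(1)]])
      show "vec n (\<lambda>i. complex_of_real (f (v $ i))) \<in> vecs_over K n"
        using R by (auto simp: vecs_over_iff)
      show "vec n (\<lambda>i. complex_of_real (f (v $ i))) \<noteq> 0\<^sub>v n"
        using k f by (metis index_vec index_zero_vec(1) of_real_eq_0_iff)
    qed
  qed
qed

text \<open>Scaling fixes the norm, and a change of phase makes the first entry real, as the
  reflection below requires.\<close>

lemma hermitian_unit_eigenvector_over:
  assumes K: "scalar_field K" and H: "H \<in> mats_over K n n" "mat_adjoint H = H" and n: "n > 0"
  obtains v e where "v \<in> vecs_over K n" "norm2 v = 1" "v $ 0 \<in> \<real>" "H *\<^sub>v v = of_real e \<cdot>\<^sub>v v"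
proof -
  obtain v e where v: "v \<in> vecs_over K n" "v \<noteq> 0\<^sub>v n" "H *\<^sub>v v = of_real e \<cdot>\<^sub>v v"
    using hermitian_eigenvector_over[OF assms] .
  have vc: "v \<in> carrier_vec n" and Hc: "H \<in> carrier_mat n n"
    using v H by (auto simp: vecs_over_iff mats_over_iff)
  \<comment> \<open>The phase \<open>p\<close> has modulus one and turns \<open>v $ 0\<close> into
    its absolute value; a vanishing entry needs its own case, since the formula would give zero
    there.\<close>
  define p where "p = (if v $ 0 = 0 then 1 else cnj (v $ 0) * of_real (inverse (cmod (v $ 0))))"
  define a where "a = p * of_real (inverse (norm2 v))"
  have nv: "norm2 v > 0"
    using norm2_eq_0_iff[of v] v vc L2_set_nonneg by (auto simp: norm2_def less_le)
  have "cmod p = 1" by (simp add: p_def norm_mult norm_inverse)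
  hence ca: "cmod a = inverse (norm2 v)" using nv by (simp add: a_def norm_mult norm_inverse)
  have aK: "a \<in> K"
    using v n unfolding a_def p_def
    by (auto intro!: scalar_field_closed[OF K] simp: vecs_over_iff simp del: of_real_inverse)
  have pr: "p * v $ 0 \<in> \<real>"
    by (auto simp: p_def mult.assoc mult.left_commute complex_is_Real_iff mult.commute)
  show thesis
  proof (rule that[of "a \<cdot>\<^sub>v v" e])
    show "a \<cdot>\<^sub>v v \<in> vecs_over K n"
      using aK v scalar_field_closed[OF K] by (auto simp: vecs_over_iff)
    show "norm2 (a \<cdot>\<^sub>v v) = 1" using nv ca by (simp add: norm2_smult)
    have "(a \<cdot>\<^sub>v v) $ 0 = of_real (inverse (norm2 v)) * (p * v $ 0)"
      using vc n by (simp add: a_def)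
    thus "(a \<cdot>\<^sub>v v) $ 0 \<in> \<real>" using pr Reals_mult Reals_of_real by metis
    show "H *\<^sub>v (a \<cdot>\<^sub>v v) = of_real e \<cdot>\<^sub>v (a \<cdot>\<^sub>v v)"
      using v(3) vc Hc by (simp add: mult_mat_vec smult_smult_assoc mult.commute)
  qed
qed

text \<open>A Householder reflection exchanges \<open>v\<close> and the first unit vector; this needs the first entry
  of \<open>v\<close> to be real.\<close>

lemma unitary_over_first_column:
  assumes K: "scalar_field K" and v: "v \<in> vecs_over K n" "norm2 v = 1" "v $ 0 \<in> \<real>" and n: "n > 0"
  obtains U where "unitary_over K n U" "col U 0 = v"
\<comment> \<open>If the first entry is 1, the unit norm leaves nothing for the other entries, and
  the identity matrix serves. Otherwise the reflection vector is nonzero.\<close>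
proof (cases "v $ 0 = 1")
  case True
  have vc: "v \<in> carrier_vec n" using v by (simp add: vecs_over_iff)
  have "(\<Sum>i<n. (cmod (v $ i))\<^sup>2) = 1"
    using v(2) vc by (simp add: norm2_def L2_set_def)
  hence "(\<Sum>i\<in>{..<n} - {0}. (cmod (v $ i))\<^sup>2) = 0"
    using n True by (simp add: sum.remove[of _ 0])
  hence "v $ i = 0" if "i < n" "i \<noteq> 0" for i
    using that by (subst (asm) sum_nonneg_eq_0_iff) auto
  hence "col (1\<^sub>m n) 0 = v"
    using True n vc by (intro eq_vecI) auto
  moreover have "unitary_over K n (1\<^sub>m n)"
    by (simp add: unitary_over_def mats_over_closed[OF K])
  ultimately show ?thesis using that by blast
next
  case False
  have vc: "v \<in> carrier_vec n" using v by (simp add: vecs_over_iff)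
  obtain r where r: "v $ 0 = of_real r" using v(3) by (auto elim: Reals_cases)
  \<comment> \<open>The reflection is \<open>I - g w w*\<close> with \<open>w\<close> the difference
    of \<open>v\<close> and the first unit vector. The squared norm of \<open>w\<close> is
    \<open>2 * (1 - r)\<close>, so \<open>g\<close> is 2 divided by it.\<close>
  define g where "g = complex_of_real (1 / (1 - r))"
  define w where "w i = v $ i - (if i = 0 then 1 else 0)" for i
  define U where "U = mat n n (\<lambda>(i, j). (if i = j then 1 else 0) - g * w i * cnj (w j))"
  have r1: "r \<noteq> 1" using False r by auto
  have nv: "(\<Sum>i<n. v $ i * cnj (v $ i)) = 1"
    using inner_self[of v] v(2) vc by (simp add: scalar_prod_def atLeast0LessThan)
  have "(\<Sum>k<n. cnj (w k) * w k)
      = (\<Sum>k<n. v $ k * cnj (v $ k) + (if k = 0 then 1 - v $ 0 - cnj (v $ 0) else 0))"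
    by (intro sum.cong) (auto simp: w_def algebra_simps)
  also have "\<dots> = of_real (2 * (1 - r))"
    using n by (simp add: sum.distrib nv r)
  finally have "g * (\<Sum>k<n. cnj (w k) * w k) = of_real (1 / (1 - r) * (2 * (1 - r)))"
    by (simp only: g_def of_real_mult)
  also have "1 / (1 - r) * (2 * (1 - r)) = 2" using r1 by (simp add: field_simps)
  finally have gw: "g * (\<Sum>k<n. cnj (w k) * w k) = 2" by simp
  have U: "U \<in> mats_over K n n"
    using v(1) n unfolding U_def g_def w_def
    by (auto simp: mats_over_iff vecs_over_iff simp del: of_real_divide intro!: scalar_field_closed[OF K])
  have adj: "mat_adjoint U = U"
    by (rule eq_matI) (auto simp: U_def g_def)
  have "U * U = 1\<^sub>m n"
  proof (rule eq_matI)
    fix i j assume "i < dim_row (1\<^sub>m n :: complex mat)" "j < dim_col (1\<^sub>m n :: complex mat)"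
    hence ij: "i < n" "j < n" by auto
    have "(U * U) $$ (i, j) = (\<Sum>k<n. ((if i = k then 1 else 0) - g * w i * cnj (w k))
                                 * ((if k = j then 1 else 0) - g * w k * cnj (w j)))"
      using ij by (subst index_mult_mat_sum) (auto simp: U_def)
    also have "\<dots> = (\<Sum>k<n. (if k = j then (if i = j then 1 else 0) - g * w i * cnj (w j) else 0)
         - (if k = i then g * w i * cnj (w j) else 0)
         + g * (cnj (w k) * w k) * (g * w i * cnj (w j)))"
      by (intro sum.cong) (auto simp: algebra_simps)
    \<comment> \<open>By \<open>gw\<close> the quadratic term is twice
      \<open>g * w i * cnj (w j)\<close> and cancels the two linear terms.\<close>
    also have "\<dots> = (if i = j then 1 else 0) - 2 * (g * w i * cnj (w j))
         + g * (\<Sum>k<n. cnj (w k) * w k) * (g * w i * cnj (w j))"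
      using ij by (simp add: sum.distrib sum_subtractf sum_distrib_left sum_distrib_right)
    also have "\<dots> = 1\<^sub>m n $$ (i, j)" unfolding gw using ij by simp
    finally show "(U * U) $$ (i, j) = 1\<^sub>m n $$ (i, j)" .
  qed (auto simp: U_def)
  moreover have "col U 0 = v"
  proof (rule eq_vecI)
    \<comment> \<open>Here \<open>w 0 = r - 1\<close>; hence the first column of \<open>U\<close> is
      the first unit vector plus \<open>w\<close>, which is \<open>v\<close>.\<close>
    have "g * cnj (w 0) = - 1"
      using r1 by (simp add: g_def w_def r field_simps)
    hence "(if i = 0 then 1 else 0) - g * w i * cnj (w 0) = v $ i" for i
      by (simp add: w_def mult.assoc mult.left_commute[of g])
    thus "col U 0 $ i = v $ i" if "i < dim_vec v" for i
      using that vc n by (simp add: U_def)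
  qed (use vc in \<open>simp add: U_def\<close>)
  ultimately show ?thesis using that[of U] U adj by (simp add: unitary_over_def)
qed

section \<open>Matrices diagonalized by a fixed unitary matrix\<close>

text \<open>For a fixed unitary \<open>U\<close> these matrices are Hermitian and commute, and
  products and differences act entrywise on \<open>d\<close>. The frame operator, its inverse and
  multiples of the identity become functions on indices.\<close>

definition conj_diag :: "complex mat \<Rightarrow> (nat \<Rightarrow> real) \<Rightarrow> complex mat" where
  "conj_diag U d = U * mat_diag (dim_row U) (\<lambda>i. of_real (d i)) * mat_adjoint U"

lemma conj_diag_dim [simp]: "dim_row (conj_diag U d) = dim_row U" "dim_col (conj_diag U d) = dim_row U"
  by (simp_all add: conj_diag_def)

lemma conj_diag_over:
  assumes "scalar_field K" "unitary_over K n U"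
  shows "conj_diag U d \<in> mats_over K n n"
  using unitary_overD[OF assms(2)] by (auto simp: conj_diag_def intro!: mats_over_closed[OF assms(1)])

lemma conj_diag_adjoint:
  assumes "unitary_over K n U"
  shows "mat_adjoint (conj_diag U d) = conj_diag U d"
  using unitary_overD[OF assms] by (simp add: conj_diag_def adjoint_mult adjoint_mat_diag mult_assoc_dim)

lemma conj_diag_mult:
  assumes "unitary_over K n U"
  shows "conj_diag U d * conj_diag U e = conj_diag U (\<lambda>i. d i * e i)"
proof -
  have "mat_diag n f * (mat_diag n g * A) = mat_diag n (\<lambda>i. f i * g i) * A"
    if "dim_row A = n" for f g and A :: "complex mat"
    using that by (simp flip: mult_assoc_dim)
  thus ?thesis
    using unitary_overD[OF assms] unitary_over_cancel[OF assms]
    by (simp add: conj_diag_def mult_assoc_dim)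
qed

lemma mat_diag_smult_one: "mat_diag n (\<lambda>i. c) = c \<cdot>\<^sub>m (1\<^sub>m n :: 'a :: semiring_1 mat)"
  by (rule eq_matI) auto

lemma conj_diag_const:
  assumes "unitary_over K n U"
  shows "conj_diag U (\<lambda>i. c) = of_real c \<cdot>\<^sub>m 1\<^sub>m n"
proof -
  note U = unitary_overD[OF assms]
  have "conj_diag U (\<lambda>i. c) = (of_real c \<cdot>\<^sub>m U) * mat_adjoint U"
    using U by (simp add: conj_diag_def mat_diag_smult_one mult_smult_distrib[OF U(2) one_carrier_mat])
  thus ?thesis
    using U by (simp add: mult_smult_assoc_mat[OF U(2) adjoint_carrier[OF U(2)]])
qed

lemma conj_diag_diff:
  assumes "unitary_over K n U"
  shows "conj_diag U d - conj_diag U e = conj_diag U (\<lambda>i. d i - e i)"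
proof -
  have "mat_diag n (\<lambda>i. of_real (d i - e i))
      = mat_diag n (\<lambda>i. complex_of_real (d i)) - mat_diag n (\<lambda>i. of_real (e i))"
    by (rule eq_matI) auto
  thus ?thesis using unitary_overD[OF assms] by (simp add: conj_diag_def mult_distribs_dim)
qed

lemma conj_diag_cancel:
  assumes "unitary_over K n U"
  shows "mat_adjoint U * (conj_diag U d * U) = mat_diag n (\<lambda>i. of_real (d i))"
  using unitary_overD[OF assms] unitary_over_cancel[OF assms] by (simp add: conj_diag_def mult_assoc_dim)

lemma conj_diag_inj:
  assumes "unitary_over K n U" "conj_diag U d = conj_diag U e" "i < n"
  shows "d i = e i"
proof -
  have "mat_diag n (\<lambda>i. complex_of_real (d i)) $$ (i, i) = mat_diag n (\<lambda>i. complex_of_real (e i)) $$ (i, i)"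
    using conj_diag_cancel[OF assms(1)] assms(2) by metis
  thus ?thesis using assms(3) by simp
qed

lemma conj_diag_trace:
  assumes "unitary_over K n U"
  shows "(\<Sum>i<n. conj_diag U d $$ (i, i)) = of_real (\<Sum>i<n. d i)"
proof -
  let ?D = "mat_diag n (\<lambda>i. complex_of_real (d i))"
  have "(\<Sum>i<n. conj_diag U d $$ (i, i)) = (\<Sum>i<n. (mat_adjoint U * (U * ?D)) $$ (i, i))"
    using diag_trace_comm[of "U * ?D" "mat_adjoint U"] unitary_overD[OF assms]
    by (simp add: conj_diag_def)
  also have "\<dots> = of_real (\<Sum>i<n. d i)"
    using unitary_over_cancel(1)[OF assms, of ?D] by simp
  finally show ?thesis .
qed

section \<open>Diagonalization by deflation\<close>

lemma adjoint_four_block_diag: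
  fixes A D :: "complex mat"
  shows "mat_adjoint (four_block_mat A (0\<^sub>m (dim_row A) (dim_col D)) (0\<^sub>m (dim_row D) (dim_col A)) D)
    = four_block_mat (mat_adjoint A) (0\<^sub>m (dim_col A) (dim_row D)) (0\<^sub>m (dim_col D) (dim_row A)) (mat_adjoint D)"
  by (rule eq_matI) auto

lemma mult_four_block_diag:
  fixes A B C D :: "'a :: semiring_1 mat"
  assumes "A \<in> carrier_mat k k" "B \<in> carrier_mat k k" "C \<in> carrier_mat n n" "D \<in> carrier_mat n n"
  shows "four_block_mat A (0\<^sub>m k n) (0\<^sub>m n k) C * four_block_mat B (0\<^sub>m k n) (0\<^sub>m n k) D
    = four_block_mat (A * B) (0\<^sub>m k n) (0\<^sub>m n k) (C * D)"
  using assms by (subst mult_four_block_mat[OF assms(1) _ _ assms(3) assms(2) _ _ assms(4)]) auto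

text \<open>Induction on the dimension: in a unitary basis that starts with a unit eigenvector,
  \<open>H\<close> splits into a real 1-by-1 block and a smaller Hermitian block.\<close>

lemma spectral_theorem_over:
  assumes K: "scalar_field K"
  shows "H \<in> mats_over K n n \<Longrightarrow> mat_adjoint H = H \<Longrightarrow> \<exists>U d. unitary_over K n U \<and> H = conj_diag U d"
proof (induction n arbitrary: H)
  case 0
  hence "unitary_over K 0 (1\<^sub>m 0)" "H = conj_diag (1\<^sub>m 0) (\<lambda>_. 0)"
    using mats_over_closed(5)[OF K] mats_over_dim[OF 0(1)]
    by (auto simp: unitary_over_def conj_diag_def intro!: eq_matI)
  thus ?case by blast
next
  case (Suc n)
  obtain v e where v: "v \<in> vecs_over K (Suc n)" "norm2 v = 1" "v $ 0 \<in> \<real>" "H *\<^sub>v v = of_real e \<cdot>\<^sub>v v"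
    using hermitian_unit_eigenvector_over[OF K Suc.prems] by auto
  obtain U where U: "unitary_over K (Suc n) U" and Uv: "col U 0 = v"
    using unitary_over_first_column[OF K v(1-3)] by auto
  note UD = unitary_overD[OF U] and UC = unitary_over_cancel[OF U]
  have HD: "dim_row H = Suc n" "dim_col H = Suc n" using mats_over_dim[OF Suc.prems(1)] .
  have vc: "v \<in> carrier_vec (Suc n)" using v by (simp add: vecs_over_iff)
  define B where "B = mat_adjoint U * (H * U)"
  have B: "B \<in> mats_over K (Suc n) (Suc n)"
    unfolding B_def
    by (rule mats_over_closed(1)[OF K mats_over_closed(4)[OF K UD(1)]
          mats_over_closed(1)[OF K Suc.prems(1) UD(1)]])
  have BD: "dim_row B = Suc n" "dim_col B = Suc n" using mats_over_dim[OF B] .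
  have B_adj: "mat_adjoint B = B"
    using UD HD Suc.prems(2) by (simp add: B_def adjoint_mult mult_assoc_dim)
  have H_eq: "H = U * (B * mat_adjoint U)"
    using UD UC HD by (simp add: B_def mult_assoc_dim)
  \<comment> \<open>The first column of \<open>B\<close> is \<open>e\<close> times the adjoint of
    \<open>U\<close> applied to \<open>v\<close>. As \<open>v\<close> is the first column of
    \<open>U\<close>, that is \<open>e\<close> times the first unit vector.\<close>
  have B_col: "B $$ (i, 0) = (if i = 0 then of_real e else 0)" if "i < Suc n" for i
  proof -
    have "col B 0 = mat_adjoint U *\<^sub>v (H *\<^sub>v v)"
      using UD HD Uv col_mult2[of H "Suc n" "Suc n" U "Suc n" 0, OF carrier_matI] unfolding B_def
      by (subst col_mult2[of _ "Suc n" "Suc n" _ "Suc n"]) auto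
    also have "\<dots> = of_real e \<cdot>\<^sub>v (mat_adjoint U *\<^sub>v v)"
      unfolding v(4) using UD vc by (intro mult_mat_vec) auto
    also have "mat_adjoint U *\<^sub>v v = col (mat_adjoint U * U) 0"
      using UD Uv by (subst col_mult2[of _ "Suc n" "Suc n" _ "Suc n"]) auto
    finally have "col B 0 $ i = (of_real e \<cdot>\<^sub>v col (1\<^sub>m (Suc n)) 0) $ i"
      unfolding UD by simp
    thus ?thesis using that BD by simp
  qed
  have B_row: "B $$ (0, j) = (if j = 0 then of_real e else 0)" if "j < Suc n" for j
    using arg_cong[OF B_adj, of "\<lambda>M. M $$ (0, j)"] B_col[OF that] that BD by auto
  define H' where "H' = mat n n (\<lambda>(i, j). B $$ (Suc i, Suc j))"
  have H': "H' \<in> mats_over K n n"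
    using B by (auto simp: H'_def mats_over_iff)
  have "mat_adjoint H' = H'"
  proof (rule eq_matI)
    fix i j assume "i < dim_row H'" "j < dim_col H'"
    thus "mat_adjoint H' $$ (i, j) = H' $$ (i, j)"
      using arg_cong[OF B_adj, of "\<lambda>M. M $$ (Suc i, Suc j)"] BD by (simp add: H'_def)
  qed (auto simp: H'_def)
  then obtain V d where V: "unitary_over K n V" and H'_eq: "H' = conj_diag V d"
    using Suc.IH[OF H'] by blast
  note VD = unitary_overD[OF V]
  \<comment> \<open>\<open>F\<close> extends \<open>V\<close> by a trivial 1-by-1 block, so that
    \<open>U * F\<close> diagonalizes \<open>H\<close>.\<close>
  define F where "F = four_block_mat (1\<^sub>m 1) (0\<^sub>m 1 n) (0\<^sub>m n 1) V"
  have F_adj: "mat_adjoint F = four_block_mat (1\<^sub>m 1) (0\<^sub>m 1 n) (0\<^sub>m n 1) (mat_adjoint V)"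
    using adjoint_four_block_diag[of "1\<^sub>m 1" V] VD by (simp add: F_def)
  have "F \<in> mats_over K (Suc n) (Suc n)"
    using VD(1) scalar_field_closed(6,7)[OF K] unfolding F_def by (auto simp: mats_over_iff)
  moreover have "mat_adjoint F * F = 1\<^sub>m (Suc n)" "F * mat_adjoint F = 1\<^sub>m (Suc n)"
    using VD unfolding F_adj by (auto simp: F_def mult_four_block_diag)
  ultimately have F: "unitary_over K (Suc n) F" by (simp add: unitary_over_def)
  define d' where "d' i = (case i of 0 \<Rightarrow> e | Suc j \<Rightarrow> d j)" for i
  have D': "mat_diag (Suc n) (\<lambda>i. complex_of_real (d' i))
      = four_block_mat (mat_diag 1 (\<lambda>i. of_real e)) (0\<^sub>m 1 n) (0\<^sub>m n 1) (mat_diag n (\<lambda>i. of_real (d i)))"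
    by (rule eq_matI) (auto simp: d'_def split: nat.splits)
  have "B = four_block_mat (mat_diag 1 (\<lambda>i. of_real e)) (0\<^sub>m 1 n) (0\<^sub>m n 1) H'"
    using BD B_col B_row by (intro eq_matI) (auto simp: H'_def)
  also have "\<dots> = F * mat_diag (Suc n) (\<lambda>i. of_real (d' i)) * mat_adjoint F"
    using VD unfolding F_adj D' unfolding F_def H'_eq conj_diag_def
    by (simp add: mult_four_block_diag[of _ "Suc 0" _ _ n])
  finally have "H = conj_diag (U * F) d'"
    using UD unitary_overD[OF F] unfolding H_eq
    by (simp add: conj_diag_def adjoint_mult mult_assoc_dim)
  thus ?case using unitary_over_mult[OF K U F] by blast
qed

subsection \<open>Frame bounds\<close>

text \<open>The inner products are the entries of the adjoint of \<open>M\<close> applied to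
  \<open>x\<close>, the frame coefficients of \<open>x\<close>.\<close>

lemma sum_cmod_inner_cols:
  assumes "M \<in> carrier_mat n m" "x \<in> carrier_vec n"
  shows "(\<Sum>i<m. (cmod (x \<bullet>c col M i))\<^sup>2) = (norm2 (mat_adjoint M *\<^sub>v x))\<^sup>2"
proof -
  have "x \<bullet>c col M i = (mat_adjoint M *\<^sub>v x) $ i" if "i < m" for i
    using assms that by (auto simp: scalar_prod_def mult.commute)
  thus ?thesis using assms by (simp add: norm2_def L2_set_def sum_nonneg)
qed

lemma norm2_unitary_adjoint:
  assumes "unitary_over K n U" "x \<in> carrier_vec n"
  shows "norm2 (mat_adjoint U *\<^sub>v x) = norm2 x"
proof -
  note U = unitary_overD[OF assms(1)]
  have "(mat_adjoint U *\<^sub>v x) \<bullet>c (mat_adjoint U *\<^sub>v x) = x \<bullet>c (U *\<^sub>v (mat_adjoint U *\<^sub>v x))"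
    using U assms(2) by (subst inner_adjoint) auto
  also have "U *\<^sub>v (mat_adjoint U *\<^sub>v x) = x"
    using U assms(2) by (metis adjoint_carrier assoc_mult_mat_vec one_mult_mat_vec)
  finally have "(norm2 (mat_adjoint U *\<^sub>v x))\<^sup>2 = (norm2 x)\<^sup>2"
    unfolding inner_self of_real_eq_iff .
  thus ?thesis by (simp add: norm2_def L2_set_nonneg)
qed

text \<open>The sum is the quadratic form of \<open>M * mat_adjoint M\<close> at \<open>x\<close>,
  evaluated in the eigenvector coordinates of \<open>x\<close>.\<close>

lemma sum_cmod_inner_cols_spectral:
  assumes M: "M \<in> carrier_mat n m" and U: "unitary_over K n U" and MM: "M * mat_adjoint M = conj_diag U d"
    and x: "x \<in> carrier_vec n"
  shows "(\<Sum>i<m. (cmod (x \<bullet>c col M i))\<^sup>2) = (\<Sum>i<n. d i * (cmod ((mat_adjoint U *\<^sub>v x) $ i))\<^sup>2)"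
proof -
  note UD = unitary_overD[OF U]
  define y where "y = mat_adjoint U *\<^sub>v x"
  define D where "D = mat_diag n (\<lambda>i. complex_of_real (d i))"
  have y: "y \<in> carrier_vec n" using UD by (simp add: y_def carrier_vecI)
  have D: "D \<in> carrier_mat n n" by (simp add: D_def)
  have "of_real ((norm2 (mat_adjoint M *\<^sub>v x))\<^sup>2) = x \<bullet>c (M *\<^sub>v (mat_adjoint M *\<^sub>v x))"
    unfolding inner_self[symmetric] using M x by (subst inner_adjoint) auto
  also have "M *\<^sub>v (mat_adjoint M *\<^sub>v x) = conj_diag U d *\<^sub>v x"
    using M x by (metis MM adjoint_carrier assoc_mult_mat_vec)
  also have "\<dots> = U *\<^sub>v (D *\<^sub>v y)"
    unfolding conj_diag_def y_def UD(3) D_def[symmetric]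
    using UD(2) D x y[unfolded y_def] by (subst assoc_mult_mat_vec[of _ n n _ n] assoc_mult_mat_vec[of U n n D n]; auto)+
  also have "x \<bullet>c (U *\<^sub>v (D *\<^sub>v y)) = y \<bullet>c (D *\<^sub>v y)"
    using UD x D y unfolding y_def by (subst inner_adjoint) auto
  also have "D *\<^sub>v y = vec n (\<lambda>i. of_real (d i) * y $ i)"
  proof (rule eq_vecI)
    fix i assume "i < dim_vec (vec n (\<lambda>i. complex_of_real (d i) * y $ i))"
    hence i: "i < n" by simp
    have "(D *\<^sub>v y) $ i = (\<Sum>j<n. (if i = j then of_real (d j) else 0) * y $ j)"
      using i y by (simp add: scalar_prod_def atLeast0LessThan D_def)
    also have "\<dots> = (\<Sum>j<n. if i = j then of_real (d j) * y $ j else 0)"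
      by (intro sum.cong) auto
    finally have "(D *\<^sub>v y) $ i = (\<Sum>j<n. if i = j then of_real (d j) * y $ j else 0)" .
    thus "(D *\<^sub>v y) $ i = vec n (\<lambda>i. complex_of_real (d i) * y $ i) $ i" using i by simp
  qed (simp add: D_def)
  also have "y \<bullet>c vec n (\<lambda>i. of_real (d i) * y $ i) = of_real (\<Sum>i<n. d i * (cmod (y $ i))\<^sup>2)"
    using y by (auto simp: scalar_prod_def atLeast0LessThan complex_norm_square mult_ac
        simp del: of_real_power intro!: sum.cong)
  finally show ?thesis
    unfolding of_real_eq_iff sum_cmod_inner_cols[OF M x] y_def .
qed

text \<open>Frame bounds are bounds for the eigenvalues of the frame operator. Necessity follows by
  testing with the columns of \<open>U\<close>, which are admissible because \<open>U\<close> has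
  entries in \<open>K\<close>.\<close>

lemma frame_bounds_iff:
  assumes K: "scalar_field K" and M: "M \<in> mats_over K n m" and U: "unitary_over K n U"
    and MM: "M * mat_adjoint M = conj_diag U d"
  shows "frame_bounds K n m M A B \<longleftrightarrow> 0 < A \<and> A \<le> B \<and> (\<forall>i<n. A \<le> d i \<and> d i \<le> B)"
proof -
  note UD = unitary_overD[OF U]
  have Mc: "M \<in> carrier_mat n m" using M by (simp add: mats_over_iff)
  note frame_sum = sum_cmod_inner_cols_spectral[OF Mc U MM]
  have norm: "(norm2 x)\<^sup>2 = (\<Sum>i<n. (cmod ((mat_adjoint U *\<^sub>v x) $ i))\<^sup>2)" if "x \<in> carrier_vec n" for x
    unfolding norm2_unitary_adjoint[OF U that, symmetric] using UD that
    by (simp add: norm2_def L2_set_def sum_nonneg)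
  show ?thesis
  proof (intro iffI conjI allI impI)
    assume fb: "frame_bounds K n m M A B"
    show "0 < A" "A \<le> B" using fb by (auto simp: frame_bounds_def)
    fix i assume i: "i < n"
    let ?x = "col U i"
    have x: "?x \<in> vecs_over K n" "?x \<in> carrier_vec n"
      using UD(1) i by (auto simp: vecs_over_iff mats_over_iff)
    have "mat_adjoint U *\<^sub>v ?x = col (1\<^sub>m n) i"
      using UD i by (metis adjoint_carrier col_mult2)
    hence y: "(mat_adjoint U *\<^sub>v ?x) $ j = (if i = j then 1 else 0)" if "j < n" for j
      using i that by (auto simp: unit_vec_def)
    have "(norm2 ?x)\<^sup>2 = (\<Sum>j<n. if i = j then 1 else 0)"
      unfolding norm[OF x(2)] by (rule sum.cong) (auto simp: y)
    moreover have "(\<Sum>k<m. (cmod (?x \<bullet>c col M k))\<^sup>2) = (\<Sum>j<n. if i = j then d j else 0)"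
      unfolding frame_sum[OF x(2)] by (rule sum.cong) (auto simp: y)
    ultimately show "A \<le> d i" "d i \<le> B"
      using fb x(1) i by (auto simp: frame_bounds_def)
  next
    assume d: "0 < A \<and> A \<le> B \<and> (\<forall>i<n. A \<le> d i \<and> d i \<le> B)"
    show "frame_bounds K n m M A B"
      unfolding frame_bounds_def
    proof (intro conjI ballI)
      fix x assume "x \<in> vecs_over K n"
      hence x: "x \<in> carrier_vec n" by (simp add: vecs_over_iff)
      show "A * (norm2 x)\<^sup>2 \<le> (\<Sum>i<m. (cmod (x \<bullet>c col M i))\<^sup>2)"
        unfolding frame_sum[OF x] norm[OF x] sum_distrib_left
        using d by (intro sum_mono mult_right_mono) auto
      show "(\<Sum>i<m. (cmod (x \<bullet>c col M i))\<^sup>2) \<le> B * (norm2 x)\<^sup>2"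
        unfolding frame_sum[OF x] norm[OF x] sum_distrib_left
        using d by (intro sum_mono mult_right_mono) auto
    qed (use d in auto)
  qed
qed

lemma gram_spectral:
  assumes "scalar_field K" "M \<in> mats_over K n m"
  obtains U d where "unitary_over K n U" "M * mat_adjoint M = conj_diag U d"
proof -
  have "M * mat_adjoint M \<in> mats_over K n n"
    using mats_over_closed[OF assms(1)] assms(2) by blast
  moreover have "mat_adjoint (M * mat_adjoint M) = M * mat_adjoint M"
    by (simp add: adjoint_mult)
  ultimately show ?thesis using spectral_theorem_over[OF assms(1)] that by blast
qed

text \<open>Equal frame bounds force all eigenvalues of the frame operator to be
  \<open>c\<close>.\<close>

lemma is_tight_frame_iff:
  assumes K: "scalar_field K" and n: "n > 0"
  shows "is_tight_frame K n m M c \<longleftrightarrow>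
    M \<in> mats_over K n m \<and> 0 < c \<and> M * mat_adjoint M = of_real c \<cdot>\<^sub>m 1\<^sub>m n"
proof (cases "M \<in> mats_over K n m")
  case True
  obtain U d where U: "unitary_over K n U" and MM: "M * mat_adjoint M = conj_diag U d"
    using gram_spectral[OF K True] .
  have "(\<forall>i<n. d i = c) \<longleftrightarrow> conj_diag U d = conj_diag U (\<lambda>i. c)"
  proof
    assume "\<forall>i<n. d i = c"
    hence "mat_diag n (\<lambda>i. complex_of_real (d i)) = mat_diag n (\<lambda>i. of_real c)"
      by (auto intro!: eq_matI)
    thus "conj_diag U d = conj_diag U (\<lambda>i. c)" using unitary_overD[OF U] by (simp add: conj_diag_def)
  qed (use conj_diag_inj[OF U] in blast)
  thus ?thesis
    unfolding is_tight_frame_def frame_bounds_iff[OF K True U MM] MM conj_diag_const[OF U, symmetric]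
    using True by (auto intro: antisym)
qed (simp add: is_tight_frame_def)

text \<open>The optimal lower bound is the smallest eigenvalue: the minimum of \<open>d\<close> is
  itself an admissible lower bound, so \<open>A\<close> cannot lie below it.\<close>

lemma optimal_lower_frame_bound_spectral:
  assumes K: "scalar_field K" and M: "M \<in> mats_over K n m" and U: "unitary_over K n U"
    and MM: "M * mat_adjoint M = conj_diag U d" and opt: "optimal_lower_frame_bound K n m M A"
  shows "0 < A" "n > 0" "\<And>i. i < n \<Longrightarrow> A \<le> d i" "\<exists>i<n. d i = A"
proof -
  note fb = frame_bounds_iff[OF K M U MM]
  obtain B where B: "0 < A" "A \<le> B" "\<forall>i<n. A \<le> d i \<and> d i \<le> B"
    and max: "\<And>A' B'. 0 < A' \<Longrightarrow> A' \<le> B' \<Longrightarrow> \<forall>i<n. A' \<le> d i \<and> d i \<le> B' \<Longrightarrow> A' \<le> A"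
    using opt unfolding optimal_lower_frame_bound_def fb by metis
  show "0 < A" "\<And>i. i < n \<Longrightarrow> A \<le> d i" using B by auto
  \<comment> \<open>In dimension zero every positive number is a lower bound, so
    \<open>A + 1\<close> would contradict the maximality of \<open>A\<close>.\<close>
  show n: "n > 0" using max[of "A + 1" "A + 1"] B(1) by (cases n) auto
  let ?m = "Min (d ` {..<n})"
  have m: "?m \<in> d ` {..<n}" using n by (intro Min_in) auto
  then obtain i where i: "i < n" "?m = d i" by auto
  moreover have "\<forall>j<n. ?m \<le> d j" by simp
  ultimately have "?m \<le> A"
    by (intro max[of _ B]) (use B in \<open>auto intro: less_le_trans order_trans simp del: Min_le_iff\<close>)
  thus "\<exists>i<n. d i = A" using i B by (intro exI[of _ i]) (auto intro: antisym)
qed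

subsection \<open>Tight duals\<close>

text \<open>The complement \<open>1 - R\<close> is again a Hermitian idempotent, hence of the form
  \<open>N * mat_adjoint N\<close> with nonnegative diagonal; so no diagonal entry of
  \<open>R\<close> exceeds 1. This takes the place of a dimension count.\<close>

lemma hermitian_idempotent_trace_le:
  fixes R :: "complex mat"
  assumes R: "R \<in> carrier_mat m m" and adj: "mat_adjoint R = R" and idem: "R * R = R"
    and tr: "(\<Sum>j<m. R $$ (j, j)) = of_real t"
  shows "t \<le> m"
proof -
  define N where "N = 1\<^sub>m m - R"
  have N: "N = N * mat_adjoint N"
    using R adj idem by (simp add: N_def adjoint_minus mult_distribs_dim) (auto intro!: eq_matI)
  have nonneg: "0 \<le> Re (N $$ (j, j))" if "j < m" for j
    using that R by (subst N, subst index_mult_adjoint_self) (auto simp: N_def sum_nonneg)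
  have "t = (\<Sum>j<m. Re (R $$ (j, j)))"
    using arg_cong[OF tr, of Re] by simp
  also have "\<dots> \<le> (\<Sum>j<m. 1)"
    using nonneg R by (intro sum_mono) (simp add: N_def)
  finally show ?thesis by simp
qed

section \<open>Duals in terms of the spectral data of the frame\<close>

locale spectral_frame =
  fixes K :: "complex set" and n m :: nat and \<Phi> U :: "complex mat" and d :: "nat \<Rightarrow> real"
  assumes K: "scalar_field K" and \<Phi>: "\<Phi> \<in> mats_over K n m" and U: "unitary_over K n U"
    and \<Phi>\<Phi>: "\<Phi> * mat_adjoint \<Phi> = conj_diag U d" and d_pos: "i < n \<Longrightarrow> 0 < d i"
begin

abbreviation "T \<equiv> conj_diag U (\<lambda>i. 1 / d i)"

lemma dims [simp]: "dim_row \<Phi> = n" "dim_col \<Phi> = m" "dim_row U = n" "dim_col U = n"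
  using mats_over_dim[OF \<Phi>] unitary_overD[OF U] by auto

lemma conj_diag_cong: "(\<And>i. i < n \<Longrightarrow> e i = f i) \<Longrightarrow> conj_diag U e = conj_diag U f"
  unfolding conj_diag_def by (intro arg_cong2[of _ _ _ _ "(*)"] refl) (auto intro!: eq_matI)

lemma conj_diag_one: "conj_diag U (\<lambda>i. 1) = 1\<^sub>m n"
  using conj_diag_const[OF U, of 1] by (auto intro!: eq_matI)

lemma TS: "T * (\<Phi> * mat_adjoint \<Phi>) = 1\<^sub>m n"
proof -
  have "T * (\<Phi> * mat_adjoint \<Phi>) = conj_diag U (\<lambda>i. 1)"
    unfolding \<Phi>\<Phi> conj_diag_mult[OF U] using d_pos by (intro conj_diag_cong) fastforce
  thus ?thesis by (simp add: conj_diag_one)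
qed

lemma ST: "\<Phi> * (mat_adjoint \<Phi> * T) = 1\<^sub>m n"
proof -
  have "conj_diag U d * T = conj_diag U (\<lambda>i. 1)"
    unfolding conj_diag_mult[OF U] using d_pos by (intro conj_diag_cong) fastforce
  thus ?thesis by (simp add: conj_diag_one flip: mult_assoc_dim \<Phi>\<Phi>)
qed

lemma T_adjoint: "mat_adjoint T = T"
  by (rule conj_diag_adjoint[OF U])

text \<open>These are \<open>TS\<close> and \<open>ST\<close> in the right-nested form that
  \<open>mult_assoc_dim\<close> produces.\<close>

lemma cancel:
  assumes "dim_row X = n"
  shows "T * (\<Phi> * (mat_adjoint \<Phi> * X)) = X" "\<Phi> * (mat_adjoint \<Phi> * (T * X)) = X"
proof -
  have "T * (\<Phi> * mat_adjoint \<Phi>) * X = X" "\<Phi> * (mat_adjoint \<Phi> * T) * X = X"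
    using TS ST assms by simp_all
  thus "T * (\<Phi> * (mat_adjoint \<Phi> * X)) = X" "\<Phi> * (mat_adjoint \<Phi> * (T * X)) = X"
    using assms by (simp_all add: mult_assoc_dim)
qed

text \<open>The matrix is the orthogonal projection onto the range of the adjoint of
  \<open>\<Phi>\<close>; cyclicity turns its trace into that of the identity of size
  \<open>n\<close>.\<close>

lemma trace_range_projection:
  "(\<Sum>j<m. (mat_adjoint \<Phi> * (T * \<Phi>)) $$ (j, j)) = of_nat n"
  using diag_trace_comm[of "mat_adjoint \<Phi>" "T * \<Phi>"] TS by (simp add: mult_assoc_dim)

text \<open>The complementary matrix is the orthogonal projection onto the kernel of
  \<open>\<Phi>\<close>. Its eigenvalues \<open>p j\<close> are 0 or 1 by idempotence, so the number
  of ones is its trace \<open>m - n\<close>.\<close>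

lemma kernel_spectral:
  obtains V p where "unitary_over K m V" "1\<^sub>m m - mat_adjoint \<Phi> * (T * \<Phi>) = conj_diag V p"
    "\<Phi> * conj_diag V p = 0\<^sub>m n m" "card {j \<in> {..<m}. p j = 1} + n = m"
proof -
  define N where "N = 1\<^sub>m m - mat_adjoint \<Phi> * (T * \<Phi>)"
  have N: "N \<in> mats_over K m m"
    unfolding N_def
    by (intro mats_over_closed(3,5)[OF K]
          mats_over_closed(1)[OF K mats_over_closed(4)[OF K \<Phi>]
            mats_over_closed(1)[OF K conj_diag_over[OF K U] \<Phi>]])
  have N_adj: "mat_adjoint N = N"
    by (simp add: N_def adjoint_minus adjoint_mult T_adjoint mult_assoc_dim)
  obtain V p where V: "unitary_over K m V" and Vp: "N = conj_diag V p"
    using spectral_theorem_over[OF K N N_adj] by blast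
  have ker: "\<Phi> * N = 0\<^sub>m n m"
    using cancel by (auto simp: N_def mult_distribs_dim mult_assoc_dim intro!: eq_matI)
  have "N * N = N"
    using ker by (subst (1) N_def) (simp add: mult_distribs_dim mult_assoc_dim mats_over_dim[OF N],
      auto simp: mats_over_dim[OF N] intro!: eq_matI)
  hence idem: "p j * p j = p j" if "j < m" for j
    using conj_diag_inj[OF V _ that, of "\<lambda>i. p i * p i" p] by (simp add: Vp conj_diag_mult[OF V])
  have "(\<Sum>j<m. N $$ (j, j)) = (\<Sum>j<m. 1 - (mat_adjoint \<Phi> * (T * \<Phi>)) $$ (j, j))"
    by (intro sum.cong) (auto simp: N_def simp del: index_mult_mat(1))
  hence "complex_of_real (\<Sum>j<m. p j) = of_real (real m - real n)"
    by (simp add: sum_subtractf trace_range_projection Vp conj_diag_trace[OF V]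
        del: of_real_sum index_mult_mat(1))
  hence "real m - real n = (\<Sum>j<m. p j)"
    unfolding of_real_eq_iff by simp
  also have "\<dots> = (\<Sum>j<m. if p j = 1 then 1 else 0)"
    using idem by (intro sum.cong) auto
  also have "\<dots> = real (card {j \<in> {..<m}. p j = 1})"
    by (simp flip: sum.inter_filter)
  finally have "card {j \<in> {..<m}. p j = 1} + n = m" by linarith
  thus ?thesis using that[OF V] Vp ker by (simp add: N_def)
qed

lemma n_le_m: "n \<le> m"
  using kernel_spectral by (metis le_add2)

lemma tight_dual_iff:
  assumes n: "n > 0"
  shows "is_tight_dual_frame K n m \<Phi> \<Psi> c \<longleftrightarrow>
    \<Psi> \<in> mats_over K n m \<and> 0 < c \<and> \<Psi> * mat_adjoint \<Psi> = of_real c \<cdot>\<^sub>m 1\<^sub>m n \<and> \<Psi> * mat_adjoint \<Phi> = 1\<^sub>m n"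
  using is_tight_frame_iff[OF K n, of m \<Psi> c]
  by (auto simp: is_tight_dual_frame_def is_dual_frame_def is_frame_def is_tight_frame_def)

text \<open>The difference \<open>W\<close> of \<open>\<Psi>\<close> and the canonical dual
  \<open>T * \<Phi>\<close> has Gram matrix \<open>c I - T\<close>, which gives positivity. The rank
  bound holds because the row spaces of \<open>W\<close> and \<open>\<Phi>\<close> are orthogonal
  inside a space of dimension \<open>m\<close>.\<close>

lemma tight_dual_necessary:
  assumes n: "n > 0" and tight: "is_tight_dual_frame K n m \<Phi> \<Psi> c"
  shows "\<forall>i<n. 1 / d i \<le> c" "card {i \<in> {..<n}. 1 / d i \<noteq> c} + n \<le> m"
proof -
  have \<Psi>: "\<Psi> \<in> mats_over K n m" "\<Psi> * mat_adjoint \<Psi> = conj_diag U (\<lambda>i. c)" "\<Psi> * mat_adjoint \<Phi> = 1\<^sub>m n"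
    using tight unfolding tight_dual_iff[OF n] by (auto simp: conj_diag_const[OF U])
  note UD = unitary_overD[OF U]
  note \<Psi>D [simp] = mats_over_dim[OF \<Psi>(1)]
  have adj1: "\<Phi> * mat_adjoint \<Psi> = 1\<^sub>m n"
    using arg_cong[OF \<Psi>(3), of mat_adjoint] by (simp add: adjoint_mult)
  define W where "W = \<Psi> - T * \<Phi>"
  \<comment> \<open>This change of basis makes the rows of \<open>Y\<close> pairwise orthogonal,
    with squared norms \<open>e i\<close>.\<close>
  define Y where "Y = mat_adjoint U * W"
  define e where "e i = c - 1 / d i" for i
  have W [simp]: "dim_row W = n" "dim_col W = m" by (simp_all add: W_def)
  have Y [simp]: "dim_row Y = n" "dim_col Y = m" by (simp_all add: Y_def)
  have W\<Phi>: "W * mat_adjoint \<Phi> = 0\<^sub>m n n"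
    using \<Psi>(3) TS by (simp add: W_def mult_distribs_dim mult_assoc_dim)
  have "W * mat_adjoint W = W * mat_adjoint \<Psi> - W * mat_adjoint \<Phi> * T"
    by (subst (2) W_def) (simp add: adjoint_minus adjoint_mult T_adjoint mult_distribs_dim mult_assoc_dim)
  also have "\<dots> = W * mat_adjoint \<Psi>"
    unfolding W\<Phi> by (auto intro!: eq_matI)
  also have "\<dots> = conj_diag U e"
    using \<Psi>(2) adj1 by (simp add: W_def mult_distribs_dim mult_assoc_dim conj_diag_diff[OF U] e_def[abs_def])
  finally have WW: "W * mat_adjoint W = conj_diag U e" .
  have YY: "Y * mat_adjoint Y = mat_diag n (\<lambda>i. of_real (e i))"
  proof -
    have "Y * mat_adjoint Y = mat_adjoint U * (W * mat_adjoint W * U)"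
      by (simp add: Y_def adjoint_mult mult_assoc_dim)
    thus ?thesis unfolding WW conj_diag_cancel[OF U] .
  qed
  have Y\<Phi>: "Y * mat_adjoint \<Phi> = 0\<^sub>m n n"
    using W\<Phi> by (simp add: Y_def mult_assoc_dim)
  have "0 \<le> e i" if "i < n" for i
  proof -
    have "complex_of_real (e i) = of_real (\<Sum>k<m. (cmod (Y $$ (i, k)))\<^sup>2)"
      using index_mult_adjoint_self[of i Y] YY that by simp
    thus ?thesis unfolding of_real_eq_iff by (simp add: sum_nonneg)
  qed
  thus "\<forall>i<n. 1 / d i \<le> c" by (auto simp: e_def)
  \<comment> \<open>Division by zero gives zero, so \<open>diag(g)\<close> is the pseudoinverse of \<open>diag(e)\<close>, and \<open>Q + R\<close> below is
    the orthogonal projection onto the row spaces of \<open>\<Phi>\<close> and \<open>Y\<close> together.\<close>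
  define g where "g i = 1 / e i" for i
  define G where "G = mat_diag n (\<lambda>i. complex_of_real (g i))"
  have G [simp]: "dim_row G = n" "dim_col G = n" "mat_adjoint G = G"
    by (simp_all add: G_def adjoint_mat_diag)
  define Q where "Q = mat_adjoint \<Phi> * (T * \<Phi>)"
  define R where "R = mat_adjoint Y * (G * Y)"
  have QR [simp]: "dim_row Q = m" "dim_col Q = m" "dim_row R = m" "dim_col R = m"
    by (simp_all add: Q_def R_def)
  have \<Phi>Y: "\<Phi> * mat_adjoint Y = 0\<^sub>m n n"
    using arg_cong[OF Y\<Phi>, of mat_adjoint] by (auto simp: adjoint_mult intro!: eq_matI)
  have QQ: "Q * Q = Q" using cancel by (simp add: Q_def mult_assoc_dim)
  have GYYG: "G * (Y * mat_adjoint Y) * G = G"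
    unfolding YY G_def by (simp, intro eq_matI) (auto simp: g_def)
  have "R * R = mat_adjoint Y * (G * (Y * mat_adjoint Y) * G * Y)"
    by (simp add: R_def mult_assoc_dim)
  hence RR: "R * R = R" unfolding GYYG R_def .
  \<comment> \<open>Orthogonality of the rows of \<open>Y\<close> and \<open>\<Phi>\<close> makes
    \<open>Q\<close> and \<open>R\<close> annihilate each other, so their sum is again
    idempotent.\<close>
  have "Y * Q = 0\<^sub>m n m"
    unfolding Q_def by (subst mult_assoc_dim[symmetric]) (simp_all add: Y\<Phi>)
  hence RQ: "R * Q = 0\<^sub>m m m" by (simp add: R_def mult_assoc_dim)
  have "\<Phi> * R = 0\<^sub>m n m"
    unfolding R_def by (subst mult_assoc_dim[symmetric]) (simp_all add: \<Phi>Y)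
  hence QR0: "Q * R = 0\<^sub>m m m" by (simp add: Q_def mult_assoc_dim)
  have "(Q + R) * (Q + R) = Q + R"
    using QQ RR RQ QR0 by (auto simp: mult_distribs_dim intro!: eq_matI)
  moreover have "mat_adjoint (Q + R) = Q + R"
    by (simp add: adjoint_add Q_def R_def adjoint_mult T_adjoint mult_assoc_dim)
  moreover have "(\<Sum>j<m. (Q + R) $$ (j, j)) = of_real (real (n + card {i \<in> {..<n}. 1 / d i \<noteq> c}))"
  proof -
    have "(\<Sum>j<m. (Q + R) $$ (j, j)) = (\<Sum>j<m. Q $$ (j, j)) + (\<Sum>j<m. R $$ (j, j))"
      by (simp add: sum.distrib)
    also have "(\<Sum>j<m. Q $$ (j, j)) = of_nat n"
      unfolding Q_def by (rule trace_range_projection)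
    also have "(\<Sum>j<m. R $$ (j, j)) = (\<Sum>i<n. (G * (Y * mat_adjoint Y)) $$ (i, i))"
      using diag_trace_comm[of "mat_adjoint Y" "G * Y"] by (simp add: R_def mult_assoc_dim)
    also have "\<dots> = (\<Sum>i<n. of_real (g i * e i))"
      unfolding YY G_def by simp
    \<comment> \<open>The product \<open>g i * e i\<close> is 1 if \<open>e i\<close> is nonzero and
      0 otherwise, so the trace of \<open>R\<close> counts the indices with
      \<open>1 / d i \<noteq> c\<close>.\<close>
    also have "\<dots> = (\<Sum>i<n. if 1 / d i \<noteq> c then 1 else 0)"
    proof (intro sum.cong refl)
      fix i
      have "g i * e i = (if 1 / d i \<noteq> c then 1 else 0)" by (simp add: g_def e_def)
      thus "complex_of_real (g i * e i) = (if 1 / d i \<noteq> c then 1 else 0)" by simp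
    qed
    also have "\<dots> = of_nat (card {i \<in> {..<n}. 1 / d i \<noteq> c})"
      by (simp flip: sum.inter_filter)
    finally show ?thesis by simp
  qed
  ultimately have "real (n + card {i \<in> {..<n}. 1 / d i \<noteq> c}) \<le> m"
    by (intro hermitian_idempotent_trace_le[of "Q + R"]) auto
  thus "card {i \<in> {..<n}. 1 / d i \<noteq> c} + n \<le> m" by linarith
qed

text \<open>The kernel of \<open>\<Phi>\<close> has room for one orthonormal vector per index with
  \<open>1 / d i \<noteq> c\<close>; suitably scaled, these vectors supply the missing part
  \<open>c I - T\<close> of the Gram matrix.\<close>

lemma tight_dual_sufficient:
  assumes n: "n > 0" and c: "\<forall>i<n. 1 / d i \<le> c" and card: "card {i \<in> {..<n}. 1 / d i \<noteq> c} + n \<le> m"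
  shows "\<exists>\<Psi>. is_tight_dual_frame K n m \<Phi> \<Psi> c"
proof -
  let ?I = "{i \<in> {..<n}. 1 / d i \<noteq> c}"
  obtain V p where V: "unitary_over K m V" and Vp: "1\<^sub>m m - mat_adjoint \<Phi> * (T * \<Phi>) = conj_diag V p"
    and ker: "\<Phi> * conj_diag V p = 0\<^sub>m n m" and p: "card {j \<in> {..<m}. p j = 1} + n = m"
    using kernel_spectral .
  note VD [simp] = unitary_overD(3,4)[OF V]
  have "card ?I \<le> card {j \<in> {..<m}. p j = 1}" using card p by linarith
  then obtain f where f: "f ` ?I \<subseteq> {j \<in> {..<m}. p j = 1}" "inj_on f ?I"
    using card_le_inj[of ?I "{j \<in> {..<m}. p j = 1}"] by auto
  \<comment> \<open>By injectivity of \<open>f\<close>, each row and column of \<open>E\<close> has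
    at most one nonzero entry; the square roots produce the diagonal \<open>c - 1 / d i\<close> in
    \<open>EE\<close>.\<close>
  define E where "E = mat n m (\<lambda>(i, j). if i \<in> ?I \<and> j = f i then complex_of_real (sqrt (c - 1 / d i)) else 0)"
  have E: "E \<in> mats_over K n m"
    using scalar_field_closed[OF K] by (auto simp: E_def mats_over_iff)
  note ED [simp] = mats_over_dim[OF E]
  \<comment> \<open>The nonzero columns of \<open>E\<close> have indices with
    \<open>p j = 1\<close>. Hence the kernel projection fixes \<open>W\<close> from the right, which
    later gives \<open>W\<Phi>\<close>.\<close>
  have Ep: "E * mat_diag m (\<lambda>i. of_real (p i)) = E"
    using f(1)[unfolded image_subset_iff] by (subst mat_diag_mult_right[of _ n]) (auto simp: E_def intro!: eq_matI)
  have EE: "E * mat_adjoint E = mat_diag n (\<lambda>i. of_real (c - 1 / d i))"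
  proof (rule eq_matI)
    fix i j assume "i < dim_row (mat_diag n (\<lambda>i. complex_of_real (c - 1 / d i)))"
      "j < dim_col (mat_diag n (\<lambda>i. complex_of_real (c - 1 / d i)))"
    hence ij: "i < n" "j < n" by auto
    have "(E * mat_adjoint E) $$ (i, j) = (\<Sum>k<m. E $$ (i, k) * cnj (E $$ (j, k)))"
      using ij by (subst index_mult_mat_sum) auto
    also have "\<dots> = (\<Sum>k<m. if k = f i then (if i = j \<and> i \<in> ?I then of_real (c - 1 / d i) else 0) else 0)"
    proof (rule sum.cong)
      fix k assume k: "k \<in> {..<m}"
      have "complex_of_real (sqrt (c - 1 / d i)) * of_real (sqrt (c - 1 / d i)) = of_real (c - 1 / d i)"
        using c ij by (simp flip: of_real_mult del: of_real_diff)
      thus "E $$ (i, k) * cnj (E $$ (j, k))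
          = (if k = f i then (if i = j \<and> i \<in> ?I then of_real (c - 1 / d i) else 0) else 0)"
        using ij k inj_onD[OF f(2), of i j] by (auto simp: E_def)
    qed simp
    also have "\<dots> = (if i = j \<and> i \<in> ?I then of_real (c - 1 / d i) else 0)"
      using f(1) by auto
    also have "\<dots> = mat_diag n (\<lambda>i. complex_of_real (c - 1 / d i)) $$ (i, j)"
      using ij by auto
    finally show "(E * mat_adjoint E) $$ (i, j) = mat_diag n (\<lambda>i. complex_of_real (c - 1 / d i)) $$ (i, j)" .
  qed auto
  define W where "W = U * (E * mat_adjoint V)"
  have W: "W \<in> mats_over K n m"
    unfolding W_def
    by (intro mats_over_closed(1)[OF K unitary_overD(1)[OF U]] mats_over_closed(1)[OF K E]
        mats_over_closed(4)[OF K] unitary_overD(1)[OF V])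
  note WD [simp] = mats_over_dim[OF W]
  have "W * conj_diag V p = U * ((E * mat_diag m (\<lambda>i. of_real (p i))) * mat_adjoint V)"
    using unitary_over_cancel[OF V] by (simp add: W_def conj_diag_def mult_assoc_dim)
  hence Wp: "W = W * conj_diag V p" by (simp add: Ep W_def)
  have "conj_diag V p * mat_adjoint \<Phi> = 0\<^sub>m m n"
    using arg_cong[OF ker, of mat_adjoint] conj_diag_adjoint[OF V]
    by (auto simp: adjoint_mult intro!: eq_matI)
  hence W\<Phi>: "W * mat_adjoint \<Phi> = 0\<^sub>m n n"
    by (subst Wp) (simp add: mult_assoc_dim)
  have \<Phi>W: "\<Phi> * mat_adjoint W = 0\<^sub>m n n"
    using arg_cong[OF W\<Phi>, of mat_adjoint] by (auto simp: adjoint_mult intro!: eq_matI)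
  have "W * mat_adjoint W = U * ((E * mat_adjoint E) * mat_adjoint U)"
    using unitary_over_cancel[OF V] by (simp add: W_def adjoint_mult mult_assoc_dim)
  hence WW: "W * mat_adjoint W = conj_diag U (\<lambda>i. c) - T"
    unfolding EE conj_diag_diff[OF U] by (simp add: conj_diag_def mult_assoc_dim)
  define \<Psi> where "\<Psi> = T * \<Phi> + W"
  have "\<Psi> \<in> mats_over K n m"
    unfolding \<Psi>_def using mats_over_closed(1,2)[OF K] conj_diag_over[OF K U] \<Phi> W by blast
  moreover have "\<Psi> * mat_adjoint \<Phi> = 1\<^sub>m n"
    using TS W\<Phi> by (simp add: \<Psi>_def mult_distribs_dim mult_assoc_dim)
  moreover have "\<Psi> * mat_adjoint \<Psi> = of_real c \<cdot>\<^sub>m 1\<^sub>m n"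
  proof -
    have "W * (mat_adjoint \<Phi> * T) = 0\<^sub>m n n"
      using W\<Phi> by (subst mult_assoc_dim[symmetric]) simp_all
    hence "\<Psi> * mat_adjoint \<Psi> = T + W * mat_adjoint W"
      using \<Phi>W ST
      by (simp add: \<Psi>_def adjoint_add adjoint_mult T_adjoint mult_distribs_dim mult_assoc_dim)
        (auto intro!: eq_matI)
    also have "\<dots> = conj_diag U (\<lambda>i. c)" unfolding WW by (auto intro!: eq_matI)
    finally show ?thesis by (simp add: conj_diag_const[OF U])
  qed
  moreover have "0 < c" using c d_pos[of 0] n by (auto intro: less_le_trans[of 0 "1 / d 0"])
  ultimately show ?thesis unfolding tight_dual_iff[OF n] by blast
qed

end

subsection \<open>Multiplicity of the smallest singular value\<close>

lemma proots_linear_factors: "proots (\<Prod>a\<leftarrow>xs. [:- a, 1:]) = mset (xs :: 'a :: idom list)"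
proof (induction xs)
  case (Cons a xs)
  have "(\<Prod>a\<leftarrow>xs. [:- a, 1:]) \<noteq> 0" by (auto simp: prod_list_zero_iff)
  thus ?case using Cons by (simp add: proots_mult del: mult_pCons_left)
qed simp

text \<open>Similarity preserves the characteristic polynomial, and for the diagonal matrix its
  roots with multiplicity are the entries of \<open>d\<close>.\<close>

lemma singular_values_spectral:
  assumes U: "unitary_over K n U" and MM: "M * mat_adjoint M = conj_diag U d"
  shows "singular_values M = rev (sort (map (\<lambda>i. sqrt (d i)) [0..<n]))"
proof -
  note UD = unitary_overD[OF U]
  let ?D = "mat_diag n (\<lambda>i. complex_of_real (d i))"
  have diag: "diag_mat ?D = map (\<lambda>i. complex_of_real (d i)) [0..<n]"
    by (simp add: diag_mat_def)
  have "similar_mat (conj_diag U d) ?D"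
    using UD by (intro similar_matI[of _ _ U "mat_adjoint U" n]) (auto simp: conj_diag_def intro!: carrier_matI)
  hence "char_poly (M * mat_adjoint M) = char_poly ?D"
    unfolding MM by (rule char_poly_similar)
  also have "\<dots> = (\<Prod>a\<leftarrow>diag_mat ?D. [:- a, 1:])"
    by (rule char_poly_upper_triangular[of _ n]) (auto simp: upper_triangular_def)
  finally have "proots (char_poly (M * mat_adjoint M)) = mset (map (\<lambda>i. complex_of_real (d i)) [0..<n])"
    by (simp only: proots_linear_factors diag)
  thus ?thesis
    by (simp add: singular_values_def image_mset.compositionality o_def flip: mset_map)
qed

text \<open>A sorted list begins with all copies of its minimum \<open>a\<close>, followed by other
  elements only.\<close>

lemma take_sorted_constant_iff:
  fixes xs :: "'a :: linorder list"
  assumes "sorted xs" and a: "a \<in> set xs" "\<And>x. x \<in> set xs \<Longrightarrow> a \<le> x" and k: "0 < k" "k \<le> length xs"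
  shows "(\<forall>s\<in>set (take k xs). \<forall>t\<in>set (take k xs). s = t) \<longleftrightarrow> k \<le> count (mset xs) a"
proof -
  define c where "c = count (mset xs) a"
  define ys where "ys = filter (\<lambda>x. x \<noteq> a) xs"
  have rep: "filter (\<lambda>x. x = a) xs = replicate c a"
    unfolding c_def by (induction xs) auto
  have "sort xs = replicate c a @ ys"
  proof (rule properties_for_sort)
    have "mset (replicate c a) + mset ys = mset xs"
      unfolding rep[symmetric] ys_def mset_filter by (rule multiset_partition[symmetric])
    thus "mset (replicate c a @ ys) = mset xs" by simp
    show "sorted (replicate c a @ ys)"
      using assms(1) a(2) by (auto simp: sorted_append ys_def intro: sorted_wrt_filter)
  qed
  hence xs: "xs = replicate c a @ ys" using sorted_sort_id[OF assms(1)] by simp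
  have c: "0 < c" using a(1) by (simp add: c_def)
  show ?thesis unfolding c_def[symmetric]
  proof
    assume const: "\<forall>s\<in>set (take k xs). \<forall>t\<in>set (take k xs). s = t"
    show "k \<le> c"
    proof (rule ccontr)
      assume "\<not> k \<le> c"
      hence "c < k" by simp
      \<comment> \<open>Position \<open>c\<close> is the first one after the copies of
        \<open>a\<close>; it would lie within the first \<open>k\<close> entries.\<close>
      have "xs ! 0 \<in> set (take k xs)" "xs ! c \<in> set (take k xs)"
        using k \<open>c < k\<close> nth_mem[of 0 "take k xs"] nth_mem[of c "take k xs"] by auto
      hence "xs ! 0 = xs ! c" using const by blast
      moreover have "xs ! 0 = a" using c by (simp add: xs nth_append)
      moreover have "xs ! c \<in> set ys" 
        using k(2) \<open>c < k\<close> arg_cong[OF xs, of length] by (subst xs) (auto simp: nth_append intro: nth_mem)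
      ultimately show False by (auto simp: ys_def)
    qed
  next
    assume "k \<le> c"
    hence "set (take k xs) \<subseteq> {a}" by (subst xs) auto
    thus "\<forall>s\<in>set (take k xs). \<forall>t\<in>set (take k xs). s = t" by blast
  qed
qed

section \<open>Existence criterion by the multiplicity of the smallest eigenvalue\<close>

locale optimal_spectral_frame = spectral_frame +
  fixes A :: real
  assumes A_pos: "0 < A" and A_le: "i < n \<Longrightarrow> A \<le> d i" and A_attained: "\<exists>i<n. d i = A"
begin

lemma n_pos: "n > 0"
  using A_attained by auto

text \<open>The eigenvalue condition need only be checked at the minimum \<open>A\<close>, and the
  rank condition is rewritten by counting complementary indices.\<close>

lemma tight_dual_exists_iff:
  "(\<exists>\<Psi>. is_tight_dual_frame K n m \<Phi> \<Psi> c) \<longleftrightarrow>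
    1 / A \<le> c \<and> 2 * n \<le> m + card {i \<in> {..<n}. d i = 1 / c}"
proof -
  \<comment> \<open>With \<open>1 / 0 = 0\<close>, the equations \<open>d i = 1 / c\<close> and
    \<open>1 / d i = c\<close> are equivalent for every real \<open>c\<close>.\<close>
  have "{..<n} = {i \<in> {..<n}. d i = 1 / c} \<union> {i \<in> {..<n}. 1 / d i \<noteq> c}"
    by auto
  hence "card {..<n} = card ({i \<in> {..<n}. d i = 1 / c} \<union> {i \<in> {..<n}. 1 / d i \<noteq> c})"
    by (rule arg_cong)
  also have "\<dots> = card {i \<in> {..<n}. d i = 1 / c} + card {i \<in> {..<n}. 1 / d i \<noteq> c}"
    by (rule card_Un_disjoint) auto
  finally have "card {i \<in> {..<n}. 1 / d i \<noteq> c} + n \<le> m \<longleftrightarrow> 2 * n \<le> m + card {i \<in> {..<n}. d i = 1 / c}"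
    unfolding card_lessThan by linarith
  moreover have "(\<forall>i<n. 1 / d i \<le> c) \<longleftrightarrow> 1 / A \<le> c"
  proof
    assume "1 / A \<le> c"
    moreover have "1 / d i \<le> 1 / A" if "i < n" for i
      using A_pos A_le[OF that] by (intro divide_left_mono) auto
    ultimately show "\<forall>i<n. 1 / d i \<le> c" by (meson order_trans)
  qed (use A_attained in blast)
  ultimately show ?thesis
    using tight_dual_necessary[OF n_pos, of _ c] tight_dual_sufficient[OF n_pos, of c] by blast
qed

text \<open>If \<open>m < 2 * n\<close>, the count requires some eigenvalue equal to
  \<open>1 / c\<close>; it is at least \<open>A\<close>, which bounds \<open>c\<close> from above by
  \<open>1 / A\<close>.\<close>

lemma tight_dual_bound:
  assumes "m < 2 * n" "is_tight_dual_frame K n m \<Phi> \<Psi> c"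
  shows "c = 1 / A"
proof -
  have c: "1 / A \<le> c" "2 * n \<le> m + card {i \<in> {..<n}. d i = 1 / c}"
    using assms(2) tight_dual_exists_iff by blast+
  hence "card {i \<in> {..<n}. d i = 1 / c} \<noteq> 0" using assms(1) by linarith
  hence "\<exists>i<n. d i = 1 / c" by (auto simp: card_eq_0_iff)
  hence "A \<le> 1 / c" using A_le by fastforce
  moreover have "0 < c" by (rule less_le_trans[OF _ c(1)]) (simp add: A_pos)
  ultimately have "c \<le> 1 / A" using A_pos by (simp add: field_simps)
  thus ?thesis using c(1) by simp
qed

lemma tight_dual_exists_iff_multiplicity:
  assumes "m < 2 * n"
  shows "(\<exists>\<Psi> c. is_tight_dual_frame K n m \<Phi> \<Psi> c) \<longleftrightarrow> 2 * n - m \<le> card {i \<in> {..<n}. d i = A}"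
proof -
  have "(\<exists>\<Psi> c. is_tight_dual_frame K n m \<Phi> \<Psi> c) \<longleftrightarrow> (\<exists>\<Psi>. is_tight_dual_frame K n m \<Phi> \<Psi> (1 / A))"
    using tight_dual_bound[OF assms] by blast
  thus ?thesis unfolding tight_dual_exists_iff by auto
qed

text \<open>The reversed list is ascending and starts with \<open>sqrt A\<close>, which occurs as
  often as \<open>A\<close> occurs among the \<open>d i\<close>.\<close>

lemma smallest_singular_values_equal_iff:
  assumes "0 < k" "k \<le> n"
  shows "(\<forall>s \<in> set (take k (rev (singular_values \<Phi>))). \<forall>t \<in> set (take k (rev (singular_values \<Phi>))). s = t)
    \<longleftrightarrow> k \<le> card {i \<in> {..<n}. d i = A}"
proof -
  let ?xs = "map (\<lambda>i. sqrt (d i)) [0..<n]"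
  have "rev (singular_values \<Phi>) = sort ?xs"
    using singular_values_spectral[OF U \<Phi>\<Phi>] by simp
  moreover have "(\<forall>s \<in> set (take k (sort ?xs)). \<forall>t \<in> set (take k (sort ?xs)). s = t)
      \<longleftrightarrow> k \<le> count (mset (sort ?xs)) (sqrt A)"
    using assms A_le A_attained by (intro take_sorted_constant_iff) auto
  moreover have "count (mset (sort ?xs)) (sqrt A) = card {i \<in> {..<n}. d i = A}"
    unfolding mset_sort count_mset count_list_eq_length_filter length_filter_conv_card
    by (auto intro!: arg_cong[of _ _ card])
  ultimately show ?thesis by simp
qed

end

section \<open>The three ranges of \<open>m\<close>\<close>

theorem theorem4p1:
  fixes K :: "complex set" and n m :: nat and \<Phi> :: "complex mat" and A :: real
  assumes "K = \<real> \<or> K = UNIV"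
    and "is_frame K n m \<Phi>"
    and "optimal_lower_frame_bound K n m \<Phi> A"
  shows "(2 * n \<le> m \<longrightarrow>
            (\<forall>c \<ge> 1 / A. \<exists>\<Psi>. is_tight_dual_frame K n m \<Phi> \<Psi> c)) \<and>
         (m + 1 = 2 * n \<longrightarrow>
            (\<exists>\<Psi> c. is_tight_dual_frame K n m \<Phi> \<Psi> c) \<and>
            (\<forall>\<Psi> c. is_tight_dual_frame K n m \<Phi> \<Psi> c \<longrightarrow> c = 1 / A)) \<and>
         (m + 1 < 2 * n \<longrightarrow>
            2 * n - m \<in> {2..n} \<and>
            ((\<exists>\<Psi> c. is_tight_dual_frame K n m \<Phi> \<Psi> c) \<longleftrightarrow>
             (\<forall>s \<in> set (take (2 * n - m) (rev (singular_values \<Phi>))).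
              \<forall>t \<in> set (take (2 * n - m) (rev (singular_values \<Phi>))). s = t)))"
proof -
  have K: "scalar_field K" using assms(1) by (simp add: scalar_field_def)
  have \<Phi>: "\<Phi> \<in> mats_over K n m" using assms(2) by (simp add: is_frame_def)
  obtain U d where U: "unitary_over K n U" and \<Phi>\<Phi>: "\<Phi> * mat_adjoint \<Phi> = conj_diag U d"
    using gram_spectral[OF K \<Phi>] .
  note opt = optimal_lower_frame_bound_spectral[OF K \<Phi> U \<Phi>\<Phi> assms(3)]
  interpret optimal_spectral_frame K n m \<Phi> U d A
    using K \<Phi> U \<Phi>\<Phi> opt less_le_trans[OF opt(1) opt(3)] by unfold_locales
  show ?thesis
  proof (intro conjI impI)
    assume "2 * n \<le> m"
    thus "\<forall>c \<ge> 1 / A. \<exists>\<Psi>. is_tight_dual_frame K n m \<Phi> \<Psi> c"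
      by (simp add: tight_dual_exists_iff)
  next
    assume m: "m + 1 = 2 * n"
    \<comment> \<open>Here \<open>2 * n - m = 1\<close>, and the minimum \<open>A\<close> has
      multiplicity at least one.\<close>
    have "{i \<in> {..<n}. d i = A} \<noteq> {}" using A_attained by auto
    hence "1 \<le> card {i \<in> {..<n}. d i = A}" by (simp add: Suc_le_eq card_gt_0_iff)
    thus "\<exists>\<Psi> c. is_tight_dual_frame K n m \<Phi> \<Psi> c"
      using m by (subst tight_dual_exists_iff_multiplicity) linarith+
    show "\<forall>\<Psi> c. is_tight_dual_frame K n m \<Phi> \<Psi> c \<longrightarrow> c = 1 / A"
      using m tight_dual_bound by simp
  next
    assume m: "m + 1 < 2 * n"
    \<comment> \<open>The upper limit is \<open>n_le_m\<close>; the lower one is the case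
      assumption.\<close>
    show range: "2 * n - m \<in> {2..n}" using m n_le_m by auto
    show "(\<exists>\<Psi> c. is_tight_dual_frame K n m \<Phi> \<Psi> c) \<longleftrightarrow>
             (\<forall>s \<in> set (take (2 * n - m) (rev (singular_values \<Phi>))).
              \<forall>t \<in> set (take (2 * n - m) (rev (singular_values \<Phi>))). s = t)"
      using m n_le_m by (simp add: tight_dual_exists_iff_multiplicity smallest_singular_values_equal_iff)
  qed
qed

end
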